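(* Let $O \subseteq \mathbb{C}^d$ be open and non-empty, $E$ a complex Banach space and $f \in \mathrm{H}^\infty(O;E)$. Then for each bp-continuous linear functional $\varphi \in \mathrm{H}^\infty(O)'$ there is a unique element $\varphi_f \in E$ such that \[ \langle \varphi_f, x' \rangle = \varphi(x' \circ f) \qquad \text{for all } x' \in E'. \] Moreover, $\varphi_f \in \overline{\mathrm{span}}\, f(O)$ (the norm-closed linear span of $f(O)$ in $E$).
   Context: A function from an open set $O \subseteq \mathbb{C}^d$ to a complex Banach space $E$ is holomorphic if it is Fréchet-differentiable with $\mathbb{C}$-linear derivative at each point of $O$. $\mathrm{H}^\infty(O;E)$ is the space of all bounded holomorphic functions $O \to E$ with the supremum norm, and $\mathrm{H}^\infty(O) := \mathrm{H}^\infty(O;\mathbb{C})$. $E'$ denotes the dual Banach space of $E$, and $\langle x, x'\rangle$ the canonical pairing of $x\in E$ and $x'\in E'$. A sequence $(f_n)_n$ of bounded functions on $O$ bp-converges to $f$ if $f_n \to f$ pointwise on $O$ and $\sup_n \|f_n\|_\infty < \infty$. A linear functional $\varphi : \mathrm{H}^\infty(O) \to \mathbb{C}$ is bp-continuous if $\varphi(f_n) \to \varphi(f)$ whenever $(f_n)_n$ is a sequence in $\mathrm{H}^\infty(O)$ that bp-converges to $f \in \mathrm{H}^\infty(O)$. *)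

theory Defs
  imports "HOL-Analysis.Analysis"
begin

text \<open>Complex Banach spaces. The real structure of a type in these classes carries no additional
  data: \<open>scaleR_scaleC\<close> forces it to be the restriction of the complex one.\<close>

class scaleC =
  fixes scaleC :: "complex \<Rightarrow> 'a \<Rightarrow> 'a"  (infixr \<open>*\<^sub>C\<close> 75)

class complex_vector = scaleC + real_vector +
  assumes scaleC_add_right: "a *\<^sub>C (x + y) = a *\<^sub>C x + a *\<^sub>C y"
    and scaleC_add_left: "(a + b) *\<^sub>C x = a *\<^sub>C x + b *\<^sub>C x"
    and scaleC_scaleC: "a *\<^sub>C b *\<^sub>C x = (a * b) *\<^sub>C x"
    and scaleR_scaleC: "r *\<^sub>R x = complex_of_real r *\<^sub>C x"

class complex_normed_vector = complex_vector + real_normed_vector +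
  assumes norm_scaleC: "norm (a *\<^sub>C x) = cmod a * norm x"

class complex_banach = complex_normed_vector + banach

instantiation complex :: complex_banach
begin

definition scaleC_complex :: "complex \<Rightarrow> complex \<Rightarrow> complex"
  where [simp]: "scaleC_complex a x = a * x"

instance
  by standard (simp_all add: algebra_simps norm_mult scaleR_conv_of_real)

end

lemma scaleC_one: "1 *\<^sub>C (x :: 'a::complex_vector) = x"
  using scaleR_scaleC[of 1 x] by simp

global_interpretation complex_vector:
  vector_space "scaleC :: complex \<Rightarrow> 'a \<Rightarrow> 'a::complex_vector"
  by unfold_locales (simp_all add: scaleC_add_right scaleC_add_left scaleC_scaleC scaleC_one)

definition dual_space :: "('e::complex_normed_vector \<Rightarrow> complex) set"
  where "dual_space = {x'. bounded_linear x' \<and> (\<forall>c v. x' (c *\<^sub>C v) = c * x' v)}"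

definition frechet_holomorphic_on ::
    "(complex ^ 'd::finite \<Rightarrow> 'e::complex_normed_vector) \<Rightarrow> (complex ^ 'd) set \<Rightarrow> bool"
  where "frechet_holomorphic_on f U \<longleftrightarrow>
    (\<forall>z\<in>U. \<exists>D. (f has_derivative D) (at z) \<and> (\<forall>c v. D (c *s v) = c *\<^sub>C D v))"

text \<open>A function on \<open>U\<close> is represented by its extension by 0 to the whole type, so that equality
  of functions on \<open>U\<close> is equality in HOL and the vector space operations are pointwise.\<close>

definition H_infty ::
    "(complex ^ 'd::finite) set \<Rightarrow> (complex ^ 'd \<Rightarrow> 'e::complex_normed_vector) set"
  where "H_infty U =
    {f. frechet_holomorphic_on f U \<and> bounded (f ` U) \<and> (\<forall>z. z \<notin> U \<longrightarrow> f z = 0)}"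

definition sup_norm_on :: "'a set \<Rightarrow> ('a \<Rightarrow> 'e::real_normed_vector) \<Rightarrow> real"
  where "sup_norm_on U f = (SUP z\<in>U. norm (f z))"

definition H_infty_dual ::
    "(complex ^ 'd::finite) set \<Rightarrow> ((complex ^ 'd \<Rightarrow> complex) \<Rightarrow> complex) set"
  where "H_infty_dual U = {\<phi>.
    (\<forall>g\<in>H_infty U. \<forall>h\<in>H_infty U. \<phi> (\<lambda>z. g z + h z) = \<phi> g + \<phi> h) \<and>
    (\<forall>c. \<forall>g\<in>H_infty U. \<phi> (\<lambda>z. c * g z) = c * \<phi> g) \<and>
    (\<exists>K. \<forall>g\<in>H_infty U. cmod (\<phi> g) \<le> K * sup_norm_on U g)}"

definition bp_converges ::
    "'a set \<Rightarrow> (nat \<Rightarrow> 'a \<Rightarrow> 'e::real_normed_vector) \<Rightarrow> ('a \<Rightarrow> 'e) \<Rightarrow> bool"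
  where "bp_converges U F f \<longleftrightarrow>
    (\<forall>z\<in>U. (\<lambda>n. F n z) \<longlonglongrightarrow> f z) \<and> (\<exists>M. \<forall>n. \<forall>z\<in>U. norm (F n z) \<le> M)"

definition bp_continuous ::
    "(complex ^ 'd::finite) set \<Rightarrow> ((complex ^ 'd \<Rightarrow> complex) \<Rightarrow> complex) \<Rightarrow> bool"
  where "bp_continuous U \<phi> \<longleftrightarrow>
    (\<forall>F g. (\<forall>n. F n \<in> H_infty U) \<and> g \<in> H_infty U \<and> bp_converges U F g
      \<longrightarrow> (\<lambda>n. \<phi> (F n)) \<longlonglongrightarrow> \<phi> g)"

end

theory Submission imports Defs begin

text \<open>
  The element to be found is a point of \<open>E\<close> that represents the functional
  \<open>x' \<mapsto> \<phi> (x' \<circ> f)\<close> of the bidual. The domain \<open>U\<close> is separable and \<open>f\<close> is continuous, so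
  a sequence \<open>x'\<^sub>n\<close> in the dual unit ball for which \<open>x'\<^sub>n \<circ> f\<close> vanishes at the first \<open>n\<close> points
  of a countable dense set gives functions \<open>x'\<^sub>n \<circ> f\<close> that are uniformly bounded and
  equicontinuous at every point and that therefore bp-converge to 0
  (\<open>bp_converges_zero_complexify\<close>). By bp-continuity, \<open>\<phi> (x'\<^sub>n \<circ> f)\<close> tends to 0. Arguing by
  contradiction, for each \<open>\<epsilon> > 0\<close> there is a finite set \<open>G\<close> in the span of \<open>f(U)\<close> such that the
  functional is at most \<open>\<epsilon> * norm x'\<close> on the annihilator of \<open>G\<close> (\<open>small_on_annihilator\<close>).

  This makes the functional norm-close to a point: by Hahn-Banach in the dual space, its
  restriction to the annihilator extends to a functional of norm at most \<open>\<epsilon>\<close>, and the difference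
  vanishes wherever the evaluations at the points of \<open>G\<close> do, so it is a linear combination of
  them, that is, evaluation at an element of the span of \<open>G\<close> (\<open>near_point_evaluation\<close>). Letting
  \<open>\<epsilon>\<close> tend to 0 gives a Cauchy sequence in the span of \<open>f(U)\<close>, because evaluation at a point has
  the norm of that point; its limit represents the functional and lies in the closed span
  (\<open>point_evaluation_in_closure\<close>). Uniqueness holds because the dual separates points.

  All of this is carried out in the real dual: a complex functional is determined by its real
  part, and \<open>complexify\<close> inverts the passage to the real part. The Hahn-Banach theorem is
  obtained from the fact that minimal sublinear functionals are linear.
\<close>

section \<open>Sublinear functionals\<close>

definition sublinear :: "('a::real_vector \<Rightarrow> real) \<Rightarrow> bool"
  where "sublinear p \<longleftrightarrow> (\<forall>x y. p (x + y) \<le> p x + p y) \<and> (\<forall>c\<ge>0. \<forall>x. p (c *\<^sub>R x) = c * p x)"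

lemma sublinear_add: "sublinear p \<Longrightarrow> p (x + y) \<le> p x + p y"
  and sublinear_scale: "sublinear p \<Longrightarrow> 0 \<le> c \<Longrightarrow> p (c *\<^sub>R x) = c * p x"
  by (auto simp: sublinear_def)

lemma sublinear_zero: "sublinear p \<Longrightarrow> p 0 = 0"
  using sublinear_scale[of p 0 0] by simp

lemma sublinear_ge_minus: "sublinear p \<Longrightarrow> - p (- x) \<le> p x"
  using sublinear_add[of p x "- x"] by (simp add: sublinear_zero)

lemma sublinearI:
  fixes p :: "'a::real_vector \<Rightarrow> real"
  assumes add: "\<And>x y. p (x + y) \<le> p x + p y"
    and scale: "\<And>c x. 0 < c \<Longrightarrow> p (c *\<^sub>R x) \<le> c * p x"
    and zero: "p 0 = 0"
  shows "sublinear p"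
proof -
  have "p (c *\<^sub>R x) = c * p x" if "c \<ge> 0" for c x
  proof (cases "c = 0")
    case False
    then have c: "0 < c" using that by simp
    have "p (inverse c *\<^sub>R c *\<^sub>R x) \<le> inverse c * p (c *\<^sub>R x)"
      using scale[of "inverse c" "c *\<^sub>R x"] c by simp
    then have "c * p x \<le> p (c *\<^sub>R x)"
      using c by (simp add: field_simps)
    then show ?thesis using scale[OF c, of x] by simp
  qed (simp add: zero)
  then show ?thesis using add by (simp add: sublinear_def)
qed

lemma sublinear_odd_imp_linear:
  assumes p: "sublinear p" and odd: "\<And>x. p (- x) \<le> - p x"
  shows "linear p"
proof (rule linearI)
  have odd_eq: "p (- x) = - p x" for x
    using odd[of x] sublinear_ge_minus[OF p, of x] by simp
  show "p (x + y) = p x + p y" for x y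
    using sublinear_add[OF p, of x y] sublinear_add[OF p, of "- x" "- y"] odd_eq[of "x + y"]
    by (simp add: odd_eq)
  show "p (c *\<^sub>R x) = c *\<^sub>R p x" for c x
  proof (cases "c \<ge> 0")
    case False
    then show ?thesis
      using sublinear_scale[OF p, of "- c" x] odd_eq[of "c *\<^sub>R x"] by simp
  qed (simp add: sublinear_scale[OF p])
qed

text \<open>The common source of the Hahn-Banach statements below. The infimal convolution
  \<open>q x = inf {p (x + k) - g k | k. k \<in> K}\<close> is the largest sublinear functional below \<open>p\<close> with
  \<open>q (- k) \<le> - g k\<close> on \<open>K\<close>. Hence every linear functional below \<open>q\<close> dominates \<open>g\<close> on \<open>K\<close>.\<close>

lemma sublinear_shrink_along_cone:
  fixes p g :: "'a::real_vector \<Rightarrow> real"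
  assumes p: "sublinear p"
    and K0: "0 \<in> K" and Kadd: "\<And>x y. x \<in> K \<Longrightarrow> y \<in> K \<Longrightarrow> x + y \<in> K"
    and Kscale: "\<And>c x. 0 \<le> c \<Longrightarrow> x \<in> K \<Longrightarrow> c *\<^sub>R x \<in> K"
    and gadd: "\<And>x y. x \<in> K \<Longrightarrow> y \<in> K \<Longrightarrow> g (x + y) = g x + g y"
    and gscale: "\<And>c x. 0 \<le> c \<Longrightarrow> x \<in> K \<Longrightarrow> g (c *\<^sub>R x) = c * g x"
    and gp: "\<And>x. x \<in> K \<Longrightarrow> g x \<le> p x"
  obtains q where "sublinear q" "\<And>x. q x \<le> p x" "\<And>x. x \<in> K \<Longrightarrow> q (- x) \<le> - g x"
proof
  define q where "q x = (INF k\<in>K. p (x + k) - g k)" for x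
  have g0: "g 0 = 0" using gscale[of 0 0] K0 by simp
  have bdd: "bdd_below ((\<lambda>k. p (x + k) - g k) ` K)" for x
  proof (rule bdd_belowI2)
    fix k assume "k \<in> K"
    then show "- p (- x) \<le> p (x + k) - g k"
      using sublinear_add[OF p, of "x + k" "- x"] gp[of k] by simp
  qed
  have low: "q x \<le> p (x + k) - g k" if "k \<in> K" for x k
    unfolding q_def by (rule cINF_lower[OF bdd that])
  show le: "q x \<le> p x" for x using low[OF K0, of x] g0 by simp
  show neg: "q (- x) \<le> - g x" if "x \<in> K" for x
    using low[OF that, of "- x"] sublinear_zero[OF p] by simp
  show "sublinear q"
  proof (rule sublinearI)
    fix x y
    have *: "q (x + y) \<le> (p (x + k) - g k) + (p (y + l) - g l)" if "k \<in> K" "l \<in> K" for k l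
      using low[OF Kadd[OF that], of "x + y"] sublinear_add[OF p, of "x + k" "y + l"] gadd[OF that]
      by (simp add: algebra_simps)
    have "q (x + y) - (p (x + k) - g k) \<le> q y" if "k \<in> K" for k
      unfolding q_def[of y] using K0 *[OF that] by (intro cINF_greatest) (auto simp: algebra_simps)
    then have "q (x + y) - q y \<le> q x"
      unfolding q_def[of x] using K0 by (intro cINF_greatest) (auto simp: algebra_simps)
    then show "q (x + y) \<le> q x + q y" by simp
  next
    fix c :: real and x assume c: "0 < c"
    have "q (c *\<^sub>R x) / c \<le> p (x + k) - g k" if k: "k \<in> K" for k
    proof -
      have "q (c *\<^sub>R x) \<le> p (c *\<^sub>R (x + k)) - g (c *\<^sub>R k)"
        using low[OF Kscale[of c k], of "c *\<^sub>R x"] c k by (simp add: scaleR_right_distrib)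
      also have "\<dots> = c * (p (x + k) - g k)"
        using c k by (simp add: sublinear_scale[OF p] gscale right_diff_distrib)
      finally show ?thesis using c by (simp add: field_simps)
    qed
    then have "q (c *\<^sub>R x) / c \<le> q x"
      unfolding q_def[of x] using K0 by (intro cINF_greatest) auto
    then show "q (c *\<^sub>R x) \<le> c * q x" using c by (simp add: field_simps)
  next
    have "0 \<le> q 0"
      unfolding q_def using K0 gp by (intro cINF_greatest) auto
    then show "q 0 = 0" using le[of 0] sublinear_zero[OF p] by simp
  qed
qed

text \<open>A sublinear \<open>p\<close> is additive on the ray through \<open>y\<close>, so it can itself serve as the
  functional prescribed on the cone. In a minimal \<open>p\<close> this forces \<open>p (- y) \<le> - p y\<close>; for the norm
  it yields a norming functional at \<open>y\<close>.\<close>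

lemma sublinear_shrink_along_ray:
  fixes p :: "'a::real_vector \<Rightarrow> real"
  assumes p: "sublinear p"
  obtains q where "sublinear q" "\<And>x. q x \<le> p x" "q (- y) \<le> - p y"
proof -
  define K where "K = (\<lambda>t. t *\<^sub>R y) ` {0..}"
  obtain q where q: "sublinear q" "\<And>x. q x \<le> p x" "\<And>x. x \<in> K \<Longrightarrow> q (- x) \<le> - p x"
  proof (rule sublinear_shrink_along_cone[OF p, of K p])
    show "0 \<in> K" by (auto simp: K_def intro: image_eqI[of _ _ 0])
    show "u + v \<in> K" if "u \<in> K" "v \<in> K" for u v
    proof -
      obtain a b where "a \<ge> 0" "b \<ge> 0" "u = a *\<^sub>R y" "v = b *\<^sub>R y"
        using \<open>u \<in> K\<close> \<open>v \<in> K\<close> by (auto simp: K_def)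
      then show ?thesis unfolding K_def
        by (intro image_eqI[of _ _ "a + b"]) (auto simp: scaleR_left_distrib)
    qed
    show "c *\<^sub>R u \<in> K" if "0 \<le> c" "u \<in> K" for c u
      using that by (auto simp: K_def)
    show "p (u + v) = p u + p v" if "u \<in> K" "v \<in> K" for u v
    proof -
      obtain a b where ab: "a \<ge> 0" "b \<ge> 0" and uv: "u = a *\<^sub>R y" "v = b *\<^sub>R y"
        using \<open>u \<in> K\<close> \<open>v \<in> K\<close> by (auto simp: K_def)
      have "p (u + v) = p ((a + b) *\<^sub>R y)" by (simp add: uv scaleR_left_distrib)
      then show ?thesis
        using ab by (simp add: uv sublinear_scale[OF p] distrib_right)
    qed
    show "p (c *\<^sub>R u) = c * p u" if "0 \<le> c" for c u
      using that by (rule sublinear_scale[OF p])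
  qed auto
  have "y \<in> K" by (auto simp: K_def intro: image_eqI[of _ _ 1])
  then show thesis using q that by blast
qed

text \<open>The bound \<open>p\<close> keeps the pointwise infimum finite, as \<open>r x \<ge> - r (- x) \<ge> - p (- x)\<close>. The
  infimum is subadditive because of two members of a chain the smaller one can be used at both
  points.\<close>

lemma sublinear_INF_chain:
  fixes p :: "'a::real_vector \<Rightarrow> real"
  assumes ne: "C \<noteq> {}" and sub: "\<And>r. r \<in> C \<Longrightarrow> sublinear r" and le: "\<And>r x. r \<in> C \<Longrightarrow> r x \<le> p x"
    and chain: "\<And>r s. r \<in> C \<Longrightarrow> s \<in> C \<Longrightarrow> r \<le> s \<or> s \<le> r"
  obtains q where "sublinear q" "\<And>r. r \<in> C \<Longrightarrow> q \<le> r"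
proof
  define q where "q x = (INF r\<in>C. r x)" for x
  have bdd: "bdd_below ((\<lambda>r. r x) ` C)" for x
  proof (rule bdd_belowI2)
    fix r assume "r \<in> C"
    then show "- p (- x) \<le> r x"
      using sublinear_ge_minus[OF sub, of r x] le[of r "- x"] by linarith
  qed
  have low: "q x \<le> r x" if "r \<in> C" for x r
    unfolding q_def by (rule cINF_lower[OF bdd that])
  then show "q \<le> r" if "r \<in> C" for r using that by (simp add: le_fun_def)
  show "sublinear q"
  proof (rule sublinearI)
    fix x y
    have *: "q (x + y) \<le> r x + s y" if "r \<in> C" "s \<in> C" for r s
      using chain[OF that]
    proof
      assume "r \<le> s"
      then show ?thesis
        using low[OF that(1), of "x + y"] sublinear_add[OF sub[OF that(1)], of x y] le_funD[of r s y]
        by linarith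
    next
      assume "s \<le> r"
      then show ?thesis
        using low[OF that(2), of "x + y"] sublinear_add[OF sub[OF that(2)], of x y] le_funD[of s r x]
        by linarith
    qed
    have "q (x + y) - r x \<le> q y" if "r \<in> C" for r
      unfolding q_def[of y] using ne *[OF that] by (intro cINF_greatest) (auto simp: algebra_simps)
    then have "q (x + y) - q y \<le> q x"
      unfolding q_def[of x] using ne by (intro cINF_greatest) (auto simp: algebra_simps)
    then show "q (x + y) \<le> q x + q y" by simp
  next
    fix c :: real and x assume c: "0 < c"
    have "q (c *\<^sub>R x) / c \<le> r x" if r: "r \<in> C" for r
      using low[OF r, of "c *\<^sub>R x"] c by (simp add: sublinear_scale[OF sub[OF r]] field_simps)
    then have "q (c *\<^sub>R x) / c \<le> q x"
      unfolding q_def[of x] using ne by (intro cINF_greatest) auto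
    then show "q (c *\<^sub>R x) \<le> c * q x" using c by (simp add: field_simps)
  next
    show "q 0 = 0"
      unfolding q_def using ne sub by (simp add: sublinear_zero cong: INF_cong)
  qed
qed

text \<open>Zorn's lemma gives a minimal sublinear functional below \<open>p\<close>. Shrinking it along the ray
  through any \<open>y\<close> does not change it, so it is odd and hence linear.\<close>

lemma linear_below_sublinear:
  fixes p :: "'a::real_vector \<Rightarrow> real"
  assumes p: "sublinear p"
  obtains s where "linear s" "\<And>x. s x \<le> p x"
proof -
  define A where "A = {q. sublinear q \<and> q \<le> p}"
  have "\<exists>m\<in>A. \<forall>a\<in>A. a \<le> m \<longrightarrow> a = m"
  proof (rule predicate_Zorn)
    show "partial_order_on A (relation_of (\<lambda>q r. r \<le> q) A)"
      by (rule partial_order_on_relation_ofI) auto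
  next
    fix C assume C: "C \<in> Chains (relation_of (\<lambda>q r. r \<le> q) A)"
    have CA: "C \<subseteq> A"
      using C unfolding Chains_def relation_of_def by auto
    have chain: "r \<le> s \<or> s \<le> r" if "r \<in> C" "s \<in> C" for r s
      using C that unfolding Chains_def relation_of_def by auto
    show "\<exists>u\<in>A. \<forall>a\<in>C. u \<le> a"
    proof (cases "C = {}")
      case True
      then show ?thesis using p by (auto simp: A_def)
    next
      case False
      obtain q where q: "sublinear q" "\<And>r. r \<in> C \<Longrightarrow> q \<le> r"
        by (rule sublinear_INF_chain[of C p])
          (use False chain CA in \<open>auto simp: A_def le_fun_def\<close>)
      obtain r where "r \<in> C" using False by blast
      then have "q \<le> p" using q(2)[of r] CA by (auto simp: A_def intro: order_trans)
      then show ?thesis using q by (auto simp: A_def)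
    qed
  qed
  then obtain m where m: "sublinear m" "m \<le> p"
    and min: "\<And>a. sublinear a \<Longrightarrow> a \<le> m \<Longrightarrow> a = m"
    unfolding A_def by (auto intro: order_trans)
  have "m (- y) \<le> - m y" for y
  proof -
    obtain q where q: "sublinear q" "\<And>x. q x \<le> m x" "q (- y) \<le> - m y"
      using sublinear_shrink_along_ray[OF m(1), of y] by blast
    have "q = m" using min[OF q(1)] q(2) by (simp add: le_fun_def)
    then show ?thesis using q(3) by simp
  qed
  then have "linear m" by (rule sublinear_odd_imp_linear[OF m(1)])
  then show thesis using m(2) by (intro that) (auto simp: le_fun_def)
qed

lemma sublinear_norm_mult: "0 \<le> C \<Longrightarrow> sublinear (\<lambda>x::'a::real_normed_vector. C * norm x)"
  using mult_left_mono[OF norm_triangle_ineq, of C]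
  by (auto simp: sublinear_def simp flip: distrib_left)

lemma Hahn_Banach_norming:
  fixes y :: "'a::real_normed_vector"
  obtains u :: "'a \<Rightarrow>\<^sub>L real" where "norm u \<le> 1" "u y = norm y"
proof -
  have "sublinear (norm :: 'a \<Rightarrow> real)" using sublinear_norm_mult[of 1] by simp
  then obtain q :: "'a \<Rightarrow> real" where q: "sublinear q" "\<And>x. q x \<le> norm x" "q (- y) \<le> - norm y"
    using sublinear_shrink_along_ray by blast
  obtain s where s: "linear s" "\<And>x. s x \<le> q x" using linear_below_sublinear[OF q(1)] by blast
  have neg: "s (- x) = - s x" for x using linear_neg[OF s(1)] .
  have le: "s x \<le> norm x" for x using s(2)[of x] q(2)[of x] by simp
  have abs: "\<bar>s x\<bar> \<le> norm x" for x using le[of x] le[of "- x"] neg[of x] by simp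
  then have bl: "bounded_linear s"
    by (intro bounded_linear_intro[where K = 1] linear_add[OF s(1)] linear_scale[OF s(1)]) auto
  show thesis
  proof
    show "norm (Blinfun s) \<le> 1"
      using abs by (intro norm_blinfun_bound) (auto simp: bounded_linear_Blinfun_apply[OF bl])
    show "Blinfun s y = norm y"
      using s(2)[of "- y"] q(3) neg[of y] le[of y] by (simp add: bounded_linear_Blinfun_apply[OF bl])
  qed
qed

text \<open>On a subspace, domination of \<open>g\<close> at both \<open>x\<close> and \<open>- x\<close> turns into equality.\<close>

lemma Hahn_Banach_dominated_extension:
  fixes p g :: "'a::real_vector \<Rightarrow> real"
  assumes p: "sublinear p" and g: "linear g" and W: "subspace W" and gp: "\<And>x. x \<in> W \<Longrightarrow> g x \<le> p x"
  obtains s where "linear s" "\<And>x. s x \<le> p x" "\<And>x. x \<in> W \<Longrightarrow> s x = g x"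
proof -
  obtain q where q: "sublinear q" "\<And>x. q x \<le> p x" "\<And>x. x \<in> W \<Longrightarrow> q (- x) \<le> - g x"
    by (rule sublinear_shrink_along_cone[OF p, of W g])
      (use W gp in \<open>auto simp: subspace_def linear_add[OF g] linear_scale[OF g]\<close>)
  obtain s where s: "linear s" "\<And>x. s x \<le> q x" using linear_below_sublinear[OF q(1)] by blast
  have ge: "g x \<le> s x" if "x \<in> W" for x
    using s(2)[of "- x"] q(3)[OF that] linear_neg[OF s(1), of x] by simp
  show thesis
  proof
    show "s x \<le> p x" for x using s(2)[of x] q(2)[of x] by simp
    show "s x = g x" if "x \<in> W" for x
      using ge[OF that] ge[OF subspace_neg[OF W that]] linear_neg[OF s(1), of x] linear_neg[OF g, of x]
      by simp
  qed fact
qed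

section \<open>Functionals on a dual space that are given by points\<close>

text \<open>The induction removes one functional \<open>e a\<close> at a time: unless \<open>e a\<close> is redundant, there is
  \<open>w\<close> with \<open>e a w = 1\<close> at which all the others vanish, and then \<open>l - l w * e a\<close> vanishes on the
  common kernel of the others, since \<open>x - e a x *\<^sub>R w\<close> lies in the kernel of all.\<close>

lemma linear_combination_of_functionals:
  fixes e :: "'i \<Rightarrow> 'a::real_vector \<Rightarrow> real"
  assumes "finite I" and "\<And>i. i \<in> I \<Longrightarrow> linear (e i)" and "linear l"
    and "\<And>x. (\<And>i. i \<in> I \<Longrightarrow> e i x = 0) \<Longrightarrow> l x = 0"
  shows "\<exists>c. \<forall>x. l x = (\<Sum>i\<in>I. c i * e i x)"
  using assms
proof (induction I arbitrary: l rule: finite_induct)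
  case empty
  then show ?case by simp
next
  case (insert a I)
  have lin_a: "linear (e a)" and lin: "\<And>i. i \<in> I \<Longrightarrow> linear (e i)" using insert.prems(1) by auto
  show ?case
  proof (cases "\<forall>x. (\<forall>i\<in>I. e i x = 0) \<longrightarrow> e a x = 0")
    case True
    then have "\<exists>c. \<forall>x. l x = (\<Sum>i\<in>I. c i * e i x)"
      using insert.prems by (intro insert.IH) auto
    then obtain c where c: "\<And>x. l x = (\<Sum>i\<in>I. c i * e i x)" by blast
    have "l x = (\<Sum>i\<in>insert a I. (c(a := 0)) i * e i x)" for x
      using insert.hyps by (auto simp: c intro: sum.cong)
    then show ?thesis by blast
  next
    case False
    then obtain w0 where w0: "\<And>i. i \<in> I \<Longrightarrow> e i w0 = 0" "e a w0 \<noteq> 0" by blast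
    define w where "w = inverse (e a w0) *\<^sub>R w0"
    have w: "\<And>i. i \<in> I \<Longrightarrow> e i w = 0" "e a w = 1"
      using w0 by (simp_all add: w_def linear_scale[OF lin] linear_scale[OF lin_a])
    have "\<exists>c. \<forall>x. l x - l w * e a x = (\<Sum>i\<in>I. c i * e i x)"
    proof (rule insert.IH)
      show "linear (e i)" if "i \<in> I" for i using lin that .
      show "linear (\<lambda>x. l x - l w * e a x)"
        by (rule linearI)
          (simp_all add: linear_add[OF insert.prems(2)] linear_scale[OF insert.prems(2)]
            linear_add[OF lin_a] linear_scale[OF lin_a] algebra_simps)
      show "l x - l w * e a x = 0" if x: "\<And>i. i \<in> I \<Longrightarrow> e i x = 0" for x
      proof -
        have "l (x - e a x *\<^sub>R w) = 0"
        proof (rule insert.prems(3))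
          fix i assume "i \<in> insert a I"
          then show "e i (x - e a x *\<^sub>R w) = 0"
            using w x lin lin_a by (auto simp: linear_diff linear_scale)
        qed
        then show ?thesis
          using insert.prems(2) by (simp add: linear_diff linear_scale mult.commute)
      qed
    qed
    then obtain c where c: "\<And>x. l x - l w * e a x = (\<Sum>i\<in>I. c i * e i x)" by blast
    have "l x = (\<Sum>i\<in>insert a I. (c(a := l w)) i * e i x)" for x
    proof -
      have "(\<Sum>i\<in>I. (c(a := l w)) i * e i x) = (\<Sum>i\<in>I. c i * e i x)"
        using insert.hyps by (intro sum.cong) auto
      then show ?thesis using insert.hyps c[of x] by simp
    qed
    then show ?thesis by blast
  qed
qed

text \<open>A functional on the dual that is small on the annihilator of a finite set is, up to a small
  error in norm, evaluation at a point of the span of this set: Hahn-Banach extends the small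
  part, and what remains factors through finitely many evaluations.\<close>

lemma near_point_evaluation:
  fixes T :: "('e::real_normed_vector \<Rightarrow>\<^sub>L real) \<Rightarrow> real"
  assumes T: "linear T" and V: "subspace V" and G: "finite G" "G \<subseteq> V" and "0 \<le> \<epsilon>"
    and small: "\<And>u. \<forall>v\<in>G. blinfun_apply u v = 0 \<Longrightarrow> T u \<le> \<epsilon> * norm u"
  shows "\<exists>y\<in>V. \<forall>u. \<bar>T u - blinfun_apply u y\<bar> \<le> \<epsilon> * norm u"
proof -
  define W where "W = {u :: 'e \<Rightarrow>\<^sub>L real. \<forall>v\<in>G. blinfun_apply u v = 0}"
  have "subspace W"
    by (auto simp: W_def subspace_def blinfun.add_left blinfun.scaleR_left)
  then obtain s where s: "linear s" "\<And>u. s u \<le> \<epsilon> * norm u" "\<And>u. u \<in> W \<Longrightarrow> s u = T u"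
    using Hahn_Banach_dominated_extension[OF sublinear_norm_mult[OF \<open>0 \<le> \<epsilon>\<close>] T] small
    unfolding W_def by (metis (mono_tags, lifting) mem_Collect_eq)
  have "\<exists>c. \<forall>u. T u - s u = (\<Sum>v\<in>G. c v * blinfun_apply u v)"
  proof (rule linear_combination_of_functionals[OF G(1)])
    show "linear (\<lambda>u::'e \<Rightarrow>\<^sub>L real. blinfun_apply u v)" for v
      by (rule linearI) (simp_all add: blinfun.add_left blinfun.scaleR_left)
    show "linear (\<lambda>u. T u - s u)" by (rule linear_compose_sub[OF T s(1)])
    show "T u - s u = 0" if "\<And>v. v \<in> G \<Longrightarrow> blinfun_apply u v = 0" for u
      using s(3)[of u] that by (simp add: W_def)
  qed
  then obtain c where c: "\<And>u. T u - s u = (\<Sum>v\<in>G. c v * blinfun_apply u v)" by blast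
  show ?thesis
  proof (intro bexI allI)
    show "(\<Sum>v\<in>G. c v *\<^sub>R v) \<in> V"
      using G(2) by (intro subspace_sum[OF V] subspace_scale[OF V]) auto
    fix u :: "'e \<Rightarrow>\<^sub>L real"
    have "T u - blinfun_apply u (\<Sum>v\<in>G. c v *\<^sub>R v) = s u"
      using c[of u] by (simp add: blinfun.sum_right blinfun.scaleR_right)
    then show "\<bar>T u - blinfun_apply u (\<Sum>v\<in>G. c v *\<^sub>R v)\<bar> \<le> \<epsilon> * norm u"
      using s(2)[of u] s(2)[of "- u"] linear_neg[OF s(1), of u] by simp
  qed
qed

text \<open>The canonical embedding into the bidual is isometric (\<open>Hahn_Banach_norming\<close>), so
  approximating points form a Cauchy sequence, and completeness supplies the point.\<close>

lemma point_evaluation_in_closure: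
  fixes T :: "('e::banach \<Rightarrow>\<^sub>L real) \<Rightarrow> real"
  assumes approx: "\<And>\<epsilon>. 0 < \<epsilon> \<Longrightarrow> \<exists>y\<in>V. \<forall>u. \<bar>T u - blinfun_apply u y\<bar> \<le> \<epsilon> * norm u"
  shows "\<exists>y\<in>closure V. \<forall>u. T u = blinfun_apply u y"
proof -
  have "\<forall>n. \<exists>y\<in>V. \<forall>u. \<bar>T u - blinfun_apply u y\<bar> \<le> inverse (real (Suc n)) * norm u"
    using approx by simp
  then obtain y where yV: "\<And>n. y n \<in> V"
    and y: "\<And>n u. \<bar>T u - blinfun_apply u (y n)\<bar> \<le> inverse (real (Suc n)) * norm u" by metis
  have dist_y: "dist (y m) (y n) \<le> inverse (real (Suc m)) + inverse (real (Suc n))" for m n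
  proof -
    obtain u :: "'e \<Rightarrow>\<^sub>L real" where u: "norm u \<le> 1" "blinfun_apply u (y m - y n) = norm (y m - y n)"
      using Hahn_Banach_norming .
    have "inverse (real (Suc k)) * norm u \<le> inverse (real (Suc k))" for k
      using u(1) by (simp add: mult_left_le)
    then have "\<bar>T u - blinfun_apply u (y k)\<bar> \<le> inverse (real (Suc k))" for k
      using y[of u k] order_trans by blast
    from this[of m] this[of n] show ?thesis
      using u(2) by (simp add: dist_norm blinfun.diff_right)
  qed
  have "Cauchy y"
  proof (rule metric_CauchyI)
    fix e :: real assume "0 < e"
    then obtain N where N: "inverse (real (Suc N)) < e / 2"
      using reals_Archimedean[of "e / 2"] by auto
    have "inverse (real (Suc m)) \<le> inverse (real (Suc N))" if "m \<ge> N" for m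
      using that by (intro le_imp_inverse_le) auto
    then show "\<exists>M. \<forall>m\<ge>M. \<forall>n\<ge>M. dist (y m) (y n) < e"
      using N dist_y by (intro exI[of _ N]) (smt (verit) field_sum_of_halves)
  qed
  then obtain l where l: "y \<longlonglongrightarrow> l" using Cauchy_convergent convergent_def by blast
  show ?thesis
  proof (intro bexI allI)
    show "l \<in> closure V" using yV l closure_sequential by blast
    fix u :: "'e \<Rightarrow>\<^sub>L real"
    have "(\<lambda>n. T u - blinfun_apply u (y n)) \<longlonglongrightarrow> 0"
    proof (rule Lim_null_comparison)
      show "\<forall>\<^sub>F n in sequentially. norm (T u - blinfun_apply u (y n)) \<le> inverse (real (Suc n)) * norm u"
        using y by simp
      show "(\<lambda>n. inverse (real (Suc n)) * norm u) \<longlonglongrightarrow> 0"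
        by (intro tendsto_mult_left_zero LIMSEQ_inverse_real_of_nat)
    qed
    moreover have "(\<lambda>n. T u - blinfun_apply u (y n)) \<longlonglongrightarrow> T u - blinfun_apply u l"
      by (intro tendsto_intros l)
    ultimately show "T u = blinfun_apply u l"
      using LIMSEQ_unique by fastforce
  qed
qed

text \<open>Sequential continuity at 0 suffices for a uniform estimate: if the estimate failed for
  every \<open>G n\<close>, the normalized witnesses would contradict the assumption on sequences.\<close>

lemma small_on_annihilator:
  fixes T :: "('e::real_normed_vector \<Rightarrow>\<^sub>L real) \<Rightarrow> real"
  assumes T: "linear T" and "0 < \<epsilon>"
    and seq: "\<And>u :: nat \<Rightarrow> 'e \<Rightarrow>\<^sub>L real. (\<And>n. norm (u n) \<le> 1) \<Longrightarrow>
      (\<And>n v. v \<in> G n \<Longrightarrow> blinfun_apply (u n) v = 0) \<Longrightarrow> (\<lambda>n. T (u n)) \<longlonglongrightarrow> 0"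
  shows "\<exists>n. \<forall>u. (\<forall>v\<in>G n. blinfun_apply u v = 0) \<longrightarrow> T u \<le> \<epsilon> * norm u"
proof (rule ccontr)
  assume "\<nexists>n. \<forall>u. (\<forall>v\<in>G n. blinfun_apply u v = 0) \<longrightarrow> T u \<le> \<epsilon> * norm u"
  then have "\<forall>n. \<exists>u. (\<forall>v\<in>G n. blinfun_apply u v = 0) \<and> \<epsilon> * norm u < T u"
    by (meson not_le)
  then obtain u where u0: "\<And>n v. v \<in> G n \<Longrightarrow> blinfun_apply (u n) v = 0"
    and u: "\<And>n. \<epsilon> * norm (u n) < T (u n)" by metis
  have pos: "0 < norm (u n)" for n
    using u[of n] linear_0[OF T] by auto
  have "(\<lambda>n. T (inverse (norm (u n)) *\<^sub>R u n)) \<longlonglongrightarrow> 0"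
    by (rule seq) (use pos u0 in \<open>auto simp: blinfun.scaleR_left\<close>)
  moreover have "\<epsilon> \<le> T (inverse (norm (u n)) *\<^sub>R u n)" for n
    using u[of n] pos[of n] by (simp add: linear_scale[OF T] field_simps)
  ultimately have "\<epsilon> \<le> 0" by (meson LIMSEQ_le_const)
  then show False using \<open>0 < \<epsilon>\<close> by simp
qed

section \<open>Complex functionals and their real parts\<close>

lemma scaleC_scaleR_commute: "a *\<^sub>C r *\<^sub>R x = r *\<^sub>R a *\<^sub>C (x :: 'a::complex_vector)"
  by (simp add: scaleR_scaleC scaleC_scaleC mult.commute)

lemma scaleC_Re_Im: "c *\<^sub>C x = Re c *\<^sub>R x + Im c *\<^sub>R \<i> *\<^sub>C (x :: 'a::complex_vector)"
  by (simp add: scaleR_scaleC scaleC_scaleC mult.commute flip: scaleC_add_left complex_eq)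

lemma scaleC_ii_ii: "\<i> *\<^sub>C \<i> *\<^sub>C x = - (x :: 'a::complex_vector)"
  using scaleR_scaleC[of "-1" x] by (simp add: scaleC_scaleC)

lemma subspace_complex_span: "subspace (complex_vector.span S)"
  by (auto simp: subspace_def scaleR_scaleC complex_vector.span_zero
      intro: complex_vector.span_add complex_vector.span_scale)

text \<open>The complex-linear functional \<open>v \<mapsto> u v - \<i> u (\<i> v)\<close>, which has real part \<open>u\<close>.\<close>

definition complexify :: "('e::complex_normed_vector \<Rightarrow>\<^sub>L real) \<Rightarrow> 'e \<Rightarrow> complex"
  where "complexify u v = Complex (u v) (- u (\<i> *\<^sub>C v))"

lemma norm_complexify_le: "cmod (complexify u v) \<le> 2 * norm u * norm v"
proof -
  have "cmod (complexify u v) \<le> \<bar>u v\<bar> + \<bar>u (\<i> *\<^sub>C v)\<bar>"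
    using cmod_le[of "complexify u v"] by (simp add: complexify_def)
  also have "\<dots> \<le> norm u * norm v + norm u * norm v"
    using add_mono[OF norm_blinfun[of u v] norm_blinfun[of u "\<i> *\<^sub>C v"]]
    by (simp only: norm_scaleC real_norm_def norm_ii mult_1)
  finally show ?thesis by (simp add: ac_simps)
qed

lemma complexify_add_right: "complexify u (v + w) = complexify u v + complexify u w"
  and complexify_diff_right: "complexify u (v - w) = complexify u v - complexify u w"
  by (simp_all add: complexify_def complex_eq_iff scaleC_add_right blinfun.add_right
      blinfun.diff_right complex_vector.scale_right_diff_distrib)

lemma complexify_add_left: "complexify (u + w) v = complexify u v + complexify w v"
  and complexify_scaleR_left: "complexify (r *\<^sub>R u) v = r * complexify u v"
  by (simp_all add: complexify_def complex_eq_iff blinfun.add_left blinfun.scaleR_left)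

lemma complexify_scaleC: "complexify u (c *\<^sub>C v) = c * complexify u v"
proof -
  have "u (c *\<^sub>C v) = Re c * u v + Im c * u (\<i> *\<^sub>C v)"
    unfolding scaleC_Re_Im[of c v] by (simp add: blinfun.add_right blinfun.scaleR_right)
  moreover have "u (\<i> *\<^sub>C c *\<^sub>C v) = Re c * u (\<i> *\<^sub>C v) - Im c * u v"
    unfolding scaleC_Re_Im[of c v]
    by (simp add: scaleC_add_right scaleC_scaleR_commute scaleC_ii_ii blinfun.add_right
        blinfun.diff_right blinfun.scaleR_right blinfun.minus_right)
  ultimately show ?thesis by (simp add: complexify_def complex_eq_iff algebra_simps)
qed

lemma complexify_in_dual_space: "complexify u \<in> dual_space"
proof -
  have "bounded_linear (complexify u)"
  proof (rule bounded_linear_intro[where K = "2 * norm u"])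
    show "complexify u (r *\<^sub>R v) = r *\<^sub>R complexify u v" for r v
      by (simp add: scaleR_scaleC complexify_scaleC)
    show "norm (complexify u v) \<le> norm v * (2 * norm u)" for v
      using norm_complexify_le[of u v] by (simp add: ac_simps)
  qed (rule complexify_add_right)
  then show ?thesis by (simp add: dual_space_def complexify_scaleC)
qed

lemma dual_space_eq_complexify:
  assumes "x' \<in> dual_space"
  shows "x' = complexify (Blinfun (\<lambda>v. Re (x' v)))"
proof
  fix v
  have "bounded_linear (\<lambda>v. Re (x' v))"
    using assms by (auto simp: dual_space_def intro: bounded_linear_compose[OF bounded_linear_Re])
  then show "x' v = complexify (Blinfun (\<lambda>v. Re (x' v))) v"
    using assms by (simp add: complexify_def dual_space_def complex_eq_iff bounded_linear_Blinfun_apply)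
qed

lemma dual_space_separates_points:
  fixes y z :: "'e::complex_normed_vector"
  assumes "\<And>x'. x' \<in> dual_space \<Longrightarrow> x' y = x' z"
  shows "y = z"
proof -
  obtain u :: "'e \<Rightarrow>\<^sub>L real" where u: "u (y - z) = norm (y - z)" using Hahn_Banach_norming .
  have "complexify u y = complexify u z" by (rule assms[OF complexify_in_dual_space])
  then have "norm (y - z) = 0" using u by (simp add: complexify_def blinfun.diff_right)
  then show ?thesis by simp
qed

section \<open>Composing with bounded holomorphic functions\<close>

lemma dual_space_comp_H_infty:
  assumes x': "x' \<in> dual_space" and f: "f \<in> H_infty U"
  shows "x' \<circ> f \<in> H_infty U"
proof -
  have bl: "bounded_linear x'" and hom: "\<And>c v. x' (c *\<^sub>C v) = c * x' v"
    using x' by (auto simp: dual_space_def)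
  have "\<exists>D. (x' \<circ> f has_derivative D) (at z) \<and> (\<forall>c v. D (c *s v) = c *\<^sub>C D v)" if z: "z \<in> U" for z
  proof -
    obtain D where D: "(f has_derivative D) (at z)" "\<And>c v. D (c *s v) = c *\<^sub>C D v"
      using f z unfolding H_infty_def frechet_holomorphic_on_def by blast
    show ?thesis
      using bounded_linear.has_derivative[OF bl D(1)] D(2) hom
      by (intro exI[of _ "\<lambda>v. x' (D v)"]) (simp add: o_def)
  qed
  moreover have "bounded ((x' \<circ> f) ` U)"
    using bounded_linear_image[OF _ bl, of "f ` U"] f by (simp add: H_infty_def image_comp)
  moreover have "(x' \<circ> f) z = 0" if "z \<notin> U" for z
    using f that linear_0[OF bounded_linear.linear[OF bl]] by (simp add: H_infty_def)
  ultimately show ?thesis by (simp add: H_infty_def frechet_holomorphic_on_def)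
qed

lemma H_infty_continuous_on:
  assumes "f \<in> H_infty U"
  shows "continuous_on U f"
proof (rule continuous_at_imp_continuous_on, rule ballI)
  fix z assume "z \<in> U"
  then obtain D where "(f has_derivative D) (at z)"
    using assms unfolding H_infty_def frechet_holomorphic_on_def by blast
  then show "isCont f z" by (rule has_derivative_continuous)
qed

text \<open>The functions in question are equicontinuous, as
  \<open>cmod (complexify (u n) (f z - f w)) \<le> 2 * norm (f z - f w)\<close>. So convergence to 0 on the dense
  set \<open>range d\<close>, where each value is eventually 0, spreads to all of \<open>U\<close>.\<close>

lemma bp_converges_zero_complexify:
  fixes u :: "nat \<Rightarrow> 'e::complex_normed_vector \<Rightarrow>\<^sub>L real" and f :: "'a::metric_space \<Rightarrow> 'e"
  assumes cont: "continuous_on U f" and bdd: "bounded (f ` U)"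
    and d: "range d \<subseteq> U" "U \<subseteq> closure (range d)"
    and u1: "\<And>n. norm (u n) \<le> 1"
    and u0: "\<And>n k. k \<le> n \<Longrightarrow> complexify (u n) (f (d k)) = 0"
  shows "bp_converges U (\<lambda>n. complexify (u n) \<circ> f) (\<lambda>_. 0)"
  unfolding bp_converges_def
proof (intro conjI ballI)
  have le: "cmod (complexify (u n) v) \<le> 2 * norm v" for n v
    using norm_complexify_le[of "u n" v] mult_right_mono[OF u1[of n], of "2 * norm v"] by simp
  obtain B where B: "\<And>z. z \<in> U \<Longrightarrow> norm (f z) \<le> B" using bdd by (auto simp: bounded_iff)
  show "\<exists>M. \<forall>n. \<forall>z\<in>U. cmod ((complexify (u n) \<circ> f) z) \<le> M"
    using le B by (intro exI[of _ "2 * B"]) (fastforce intro: order_trans)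
  fix z assume z: "z \<in> U"
  show "(\<lambda>n. (complexify (u n) \<circ> f) z) \<longlonglongrightarrow> 0"
  proof (rule LIMSEQ_I)
    fix e :: real assume "0 < e"
    then obtain r where r: "0 < r" "\<And>w. w \<in> U \<Longrightarrow> dist w z < r \<Longrightarrow> dist (f w) (f z) < e / 2"
      using cont z unfolding continuous_on_iff by (metis half_gt_zero)
    have "z \<in> closure (range d)" using z d(2) by blast
    then obtain k where "dist (d k) z < r" using r(1) by (auto simp: closure_approachable)
    then have close: "norm (f z - f (d k)) < e / 2"
      using r(2)[of "d k"] d(1) by (auto simp: dist_norm norm_minus_commute)
    have "norm ((complexify (u n) \<circ> f) z - 0) < e" if "n \<ge> k" for n
    proof -
      have "complexify (u n) (f z) = complexify (u n) (f z - f (d k))"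
        using u0[OF that] by (simp add: complexify_diff_right)
      then show ?thesis using le[of n "f z - f (d k)"] close by simp
    qed
    then show "\<exists>n0. \<forall>n\<ge>n0. norm ((complexify (u n) \<circ> f) z - 0) < e" by blast
  qed
qed

section \<open>Bp-continuous functionals applied to vector-valued functions\<close>

theorem theorem3p1:
  fixes U :: "(complex ^ 'd::finite) set"
    and f :: "complex ^ 'd \<Rightarrow> 'e::complex_banach"
    and \<phi> :: "(complex ^ 'd \<Rightarrow> complex) \<Rightarrow> complex"
  assumes "open U" and "U \<noteq> {}"
    and "f \<in> H_infty U"
    and "\<phi> \<in> H_infty_dual U" and "bp_continuous U \<phi>"
  shows "(\<exists>!y. \<forall>x'\<in>dual_space. x' y = \<phi> (x' \<circ> f)) \<and>
    (\<forall>y. (\<forall>x'\<in>dual_space. x' y = \<phi> (x' \<circ> f)) \<longrightarrow>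
      y \<in> closure (complex_vector.span (f ` U)))"
proof -
  let ?V = "complex_vector.span (f ` U)"
  have \<phi>_add: "\<phi> (\<lambda>z. g z + h z) = \<phi> g + \<phi> h" if "g \<in> H_infty U" "h \<in> H_infty U" for g h
    using assms(4) that by (simp add: H_infty_dual_def)
  have \<phi>_scale: "\<phi> (\<lambda>z. c * g z) = c * \<phi> g" if "g \<in> H_infty U" for c g
    using assms(4) that by (simp add: H_infty_dual_def)
  have in_H: "complexify u \<circ> f \<in> H_infty U" for u :: "'e \<Rightarrow>\<^sub>L real"
    by (rule dual_space_comp_H_infty[OF complexify_in_dual_space assms(3)])
  have zero_in_H: "(\<lambda>_. 0 :: complex) \<in> H_infty U"
    using in_H[of 0] by (simp add: o_def complexify_def flip: zero_complex.code)
  have \<phi>_zero: "\<phi> (\<lambda>_. 0) = 0" using \<phi>_scale[OF zero_in_H, of 0] by simp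
  define T where "T u = Re (\<phi> (complexify u \<circ> f))" for u :: "'e \<Rightarrow>\<^sub>L real"
  have T: "linear T"
  proof (rule linearI)
    show "T (u + w) = T u + T w" for u w
      using \<phi>_add[OF in_H in_H, of u w] by (simp add: T_def o_def complexify_add_left)
    show "T (r *\<^sub>R u) = r *\<^sub>R T u" for r u
      using \<phi>_scale[OF in_H, of "complex_of_real r" u] by (simp add: T_def o_def complexify_scaleR_left)
  qed
  obtain D where D: "countable D" "D \<subseteq> U" "U \<subseteq> closure D" using separable[of U] .
  have "D \<noteq> {}" using D(3) assms(2) by auto
  define d where "d = from_nat_into D"
  have d: "range d = D" unfolding d_def by (rule range_from_nat_into[OF \<open>D \<noteq> {}\<close> D(1)])
  \<comment> \<open>The points \<open>\<i> *\<^sub>C f (d k)\<close> are included so that a real functional that vanishes on \<open>G n\<close>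
      has a complexification that vanishes at \<open>f (d k)\<close>.\<close>
  define G where "G n = (\<Union>k\<le>n. {f (d k), \<i> *\<^sub>C f (d k)})" for n
  have "f (d k) \<in> ?V" for k
    using D(2) d by (intro complex_vector.span_base) auto
  then have G: "finite (G n)" "G n \<subseteq> ?V" for n
    by (auto simp: G_def complex_vector.span_scale)
  have seq: "(\<lambda>n. T (u n)) \<longlonglongrightarrow> 0"
    if "\<And>n. norm (u n) \<le> 1" and u0: "\<And>n v. v \<in> G n \<Longrightarrow> blinfun_apply (u n) v = 0"
    for u :: "nat \<Rightarrow> 'e \<Rightarrow>\<^sub>L real"
  proof -
    have "bp_converges U (\<lambda>n. complexify (u n) \<circ> f) (\<lambda>_. 0)"
    proof (rule bp_converges_zero_complexify[of U f d])
      show "complexify (u n) (f (d k)) = 0" if "k \<le> n" for n k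
        using u0[of "f (d k)" n] u0[of "\<i> *\<^sub>C f (d k)" n] that
        by (auto simp: G_def complexify_def complex_eq_iff)
    qed (use assms(3) D d that in \<open>auto simp: H_infty_continuous_on H_infty_def[of U]\<close>)
    then have "(\<lambda>n. \<phi> (complexify (u n) \<circ> f)) \<longlonglongrightarrow> \<phi> (\<lambda>_. 0)"
      using assms(5)[unfolded bp_continuous_def, rule_format,
          of "\<lambda>n. complexify (u n) \<circ> f" "\<lambda>_. 0"] in_H zero_in_H by simp
    from tendsto_Re[OF this] show ?thesis by (simp add: T_def \<phi>_zero)
  qed
  have "\<exists>y\<in>closure ?V. \<forall>u. T u = blinfun_apply u y"
  proof (rule point_evaluation_in_closure)
    fix \<epsilon> :: real assume "0 < \<epsilon>"
    have "\<exists>n. \<forall>u. (\<forall>v\<in>G n. blinfun_apply u v = 0) \<longrightarrow> T u \<le> \<epsilon> * norm u"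
      by (rule small_on_annihilator[OF T \<open>0 < \<epsilon>\<close> seq])
    then obtain n where n: "\<And>u. \<forall>v\<in>G n. blinfun_apply u v = 0 \<Longrightarrow> T u \<le> \<epsilon> * norm u" by blast
    show "\<exists>y\<in>?V. \<forall>u. \<bar>T u - blinfun_apply u y\<bar> \<le> \<epsilon> * norm u"
      by (rule near_point_evaluation[OF T subspace_complex_span G less_imp_le[OF \<open>0 < \<epsilon>\<close>] n])
  qed
  then obtain y where y: "y \<in> closure ?V" "\<And>u. T u = blinfun_apply u y" by blast
  have Re_eq: "Re (x' y) = Re (\<phi> (x' \<circ> f))" if "x' \<in> dual_space" for x'
  proof -
    from dual_space_eq_complexify[OF that] obtain u where u: "x' = complexify u" by blast
    then show ?thesis using y(2)[of u] by (simp add: T_def complexify_def)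
  qed
  have eq: "x' y = \<phi> (x' \<circ> f)" if "x' \<in> dual_space" for x'
  proof (rule complex_eqI)
    show "Re (x' y) = Re (\<phi> (x' \<circ> f))" by (rule Re_eq[OF that])
    \<comment> \<open>The imaginary part of \<open>x'\<close> is the real part of \<open>- \<i> * x'\<close>.\<close>
    have "(\<lambda>v. - \<i> * x' v) \<in> dual_space"
      using that bounded_linear_compose[OF bounded_linear_mult_right, of x' "- \<i>"]
      by (simp add: dual_space_def)
    from Re_eq[OF this] show "Im (x' y) = Im (\<phi> (x' \<circ> f))"
      using \<phi>_scale[OF dual_space_comp_H_infty[OF that assms(3)], of "- \<i>"] by (simp add: o_def)
  qed
  have uniq: "z = y" if "\<forall>x'\<in>dual_space. x' z = \<phi> (x' \<circ> f)" for z
  proof (rule dual_space_separates_points)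
    fix x' :: "'e \<Rightarrow> complex" assume x': "x' \<in> dual_space"
    show "x' z = x' y" by (rule trans[OF bspec[OF that x'] eq[OF x', symmetric]])
  qed
  show ?thesis
  proof (intro conjI ex1I allI impI)
    show "\<forall>x'\<in>dual_space. x' y = \<phi> (x' \<circ> f)" using eq by blast
    show "z = y" if "\<forall>x'\<in>dual_space. x' z = \<phi> (x' \<circ> f)" for z by (rule uniq[OF that])
    show "z \<in> closure ?V" if "\<forall>x'\<in>dual_space. x' z = \<phi> (x' \<circ> f)" for z
      using uniq[OF that] y(1) by simp
  qed
qed

end
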